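(* Let $G$ be an ordinary star-like self-contained graph. Then $G$ has either no strong twin or infinitely many (pairwise non-isomorphic) strong twins.
   Context: Graphs may be infinite; $\subset$ denotes the subgraph relation. For an induced subgraph $H$ of a graph $G$, $G\setminus H$ denotes the induced subgraph $G[V(G)\setminus V(H)]$. Strong twins: two non-isomorphic graphs $G$ and $T$ are strong twins if $G$ is isomorphic to a proper induced subgraph of $T$ and $T$ is isomorphic to a proper induced subgraph of $G$. Self-contained graph: an infinite graph that is isomorphic to one of its proper induced subgraphs. Removable subgraph: for a self-contained graph $G$, a non-empty proper (induced) subgraph $H$ is removable, written $H\in\mathrm{Rem}(G)$, if $G\setminus H\cong G$. In this case $\mathrm{Iso}_G(H)$ is the set of all isomorphisms $f:G\to G\setminus H$. Well-mannered: $H\in\mathrm{Rem}(G)$ is a well-mannered removable subgraph of $G$ if for each $f\in\mathrm{Iso}_G(H)$ there is an automorphism $\alpha\in\mathrm{Aut}(G)$ such that $f(H)=\alpha(H)$, $\alpha^2(H)=H$, and $\alpha(v)=v$ for all vertices $v\notin H\cup f(H)$. Star-like: a self-contained graph $G$ is star-like if all of its removable subgraphs are well-mannered. Ordinary: a star-like self-contained graph $G$ is ordinary if for each $H\in\mathrm{Rem}(G)$ which contains a non-empty induced subgraph $P\subset H$ with $P\notin\mathrm{Rem}(G)$, there exists a non-empty induced subgraph $P'\subset H$ with $P'\notin\mathrm{Rem}(G)$ such that $H\setminus P'$ is a finite graph. *)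

theory Defs
  imports Main
begin

text \<open>
  Undirected simple graphs with an arbitrary, possibly infinite, vertex set. Only values satisfying
  \<open>simple_graph\<close> are graphs. The edge set is required to live on the vertex set, so
  equality of such values is equality of graphs.
\<close>

datatype 'a graph = Graph (verts: "'a set") (edges: "'a set set")

definition simple_graph :: "'a graph \<Rightarrow> bool" where
  "simple_graph G \<longleftrightarrow> (\<forall>e\<in>edges G. e \<subseteq> verts G \<and> card e = 2)"

definition induce :: "'a graph \<Rightarrow> 'a set \<Rightarrow> 'a graph" where
  "induce G W = Graph (verts G \<inter> W) {e \<in> edges G. e \<subseteq> W}"

definition induced_subgraph :: "'a graph \<Rightarrow> 'a graph \<Rightarrow> bool" where
  "induced_subgraph H G \<longleftrightarrow> verts H \<subseteq> verts G \<and> H = induce G (verts H)"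

definition proper_induced_subgraph :: "'a graph \<Rightarrow> 'a graph \<Rightarrow> bool" where
  "proper_induced_subgraph H G \<longleftrightarrow> induced_subgraph H G \<and> H \<noteq> G"

definition graph_diff :: "'a graph \<Rightarrow> 'a graph \<Rightarrow> 'a graph" where
  "graph_diff G H = induce G (verts G - verts H)"

text \<open>
  The values of an isomorphism outside the vertex set of its source are irrelevant.
\<close>

definition graph_iso :: "('a \<Rightarrow> 'b) \<Rightarrow> 'a graph \<Rightarrow> 'b graph \<Rightarrow> bool" where
  "graph_iso f G H \<longleftrightarrow> bij_betw f (verts G) (verts H) \<and>
     (\<forall>u\<in>verts G. \<forall>v\<in>verts G. {u, v} \<in> edges G \<longleftrightarrow> {f u, f v} \<in> edges H)"

definition isomorphic :: "'a graph \<Rightarrow> 'b graph \<Rightarrow> bool" where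
  "isomorphic G H \<longleftrightarrow> (\<exists>f. graph_iso f G H)"

definition Aut :: "'a graph \<Rightarrow> ('a \<Rightarrow> 'a) set" where
  "Aut G = {\<alpha>. graph_iso \<alpha> G G}"

definition image_graph :: "('a \<Rightarrow> 'b) \<Rightarrow> 'a graph \<Rightarrow> 'b graph" where
  "image_graph f H = Graph (f ` verts H) ((\<lambda>e. f ` e) ` edges H)"

text \<open>
  The two graphs may have different vertex types. A strong twin of \<open>G\<close> embeds into \<open>G\<close>, so it has
  an isomorphic copy with the vertex type of \<open>G\<close>; counting strong twins up to isomorphism on that
  type alone therefore loses none.
\<close>

definition strong_twins :: "'a graph \<Rightarrow> 'b graph \<Rightarrow> bool" where
  "strong_twins G T \<longleftrightarrow> simple_graph G \<and> simple_graph T \<and> \<not> isomorphic G T \<and>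
     (\<exists>H. proper_induced_subgraph H T \<and> isomorphic G H) \<and>
     (\<exists>H. proper_induced_subgraph H G \<and> isomorphic T H)"

definition self_contained :: "'a graph \<Rightarrow> bool" where
  "self_contained G \<longleftrightarrow> simple_graph G \<and> infinite (verts G) \<and>
     (\<exists>H. proper_induced_subgraph H G \<and> isomorphic G H)"

definition Rem :: "'a graph \<Rightarrow> 'a graph set" where
  "Rem G = {H. proper_induced_subgraph H G \<and> verts H \<noteq> {} \<and> isomorphic (graph_diff G H) G}"

definition Iso :: "'a graph \<Rightarrow> 'a graph \<Rightarrow> ('a \<Rightarrow> 'a) set" where
  "Iso G H = {f. graph_iso f G (graph_diff G H)}"

definition well_mannered :: "'a graph \<Rightarrow> 'a graph \<Rightarrow> bool" where
  "well_mannered G H \<longleftrightarrow> H \<in> Rem G \<and>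
     (\<forall>f\<in>Iso G H. \<exists>\<alpha>\<in>Aut G.
        image_graph f H = image_graph \<alpha> H \<and>
        image_graph (\<alpha> \<circ> \<alpha>) H = H \<and>
        (\<forall>v\<in>verts G. v \<notin> verts H \<union> verts (image_graph f H) \<longrightarrow> \<alpha> v = v))"

definition star_like :: "'a graph \<Rightarrow> bool" where
  "star_like G \<longleftrightarrow> self_contained G \<and> (\<forall>H\<in>Rem G. well_mannered G H)"

definition ordinary :: "'a graph \<Rightarrow> bool" where
  "ordinary G \<longleftrightarrow> star_like G \<and>
     (\<forall>H\<in>Rem G.
        (\<exists>P. induced_subgraph P H \<and> verts P \<noteq> {} \<and> P \<notin> Rem G) \<longrightarrow>
        (\<exists>P'. induced_subgraph P' H \<and> verts P' \<noteq> {} \<and> P' \<notin> Rem G \<and>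
              finite (verts (graph_diff H P'))))"

end

theory Submission
  imports Defs
begin

text \<open>
  Call a vertex set \<open>K\<close> removable if \<open>G\<close> is isomorphic to the graph that remains after deleting
  \<open>K\<close>. Let \<open>f\<close> be such an isomorphism. Composing \<open>f\<close> with automorphisms and applying
  well-manneredness again and again, one finds for every \<open>n\<close> an automorphism that moves \<open>K\<close> onto
  \<open>f\<^sup>n(K)\<close> and fixes every vertex outside these two sets (\<open>star_like_copies\<close>). Hence \<open>G\<close> consists
  of infinitely many disjoint copies of \<open>K\<close>, which every vertex outside sees in the same way, and
  of further vertices; every injection of the index set into itself induces an embedding of \<open>G\<close>
  into itself (\<open>shift_embedding\<close>).

  A strong twin of \<open>G\<close> sits between \<open>G\<close> and a copy of \<open>G\<close> inside \<open>G\<close>. Since \<open>G\<close> is ordinary,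
  adding vertices one at a time to such a copy leads to a removable set \<open>K\<close> with a vertex \<open>x\<close> such
  that \<open>K - {x}\<close> is neither empty nor removable (\<open>ordinary_critical_vertex\<close>). Let \<open>T n\<close> arise from
  \<open>G\<close> by cutting each of the first \<open>n\<close> copies of \<open>K\<close> down to its copy of \<open>x\<close>. It contains the
  graph left by deleting these \<open>n\<close> copies, which is isomorphic to \<open>G\<close>. So \<open>T 0 = G\<close>, and each later
  \<open>T n\<close> is a strong twin of \<open>G\<close> as soon as the graphs \<open>T n\<close> are pairwise non-isomorphic.

  For that, suppose that \<open>\<psi>\<close> is an isomorphism from \<open>T n\<close> to \<open>T m\<close> with \<open>n < m\<close>. There are more
  truncated copies in \<open>T m\<close> than in \<open>T n\<close>, so \<open>\<psi>\<close> sends some vertex \<open>d\<close>, other than the \<open>n\<close> vertices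
  left over in \<open>T n\<close>, to a left-over vertex of \<open>T m\<close>. Now \<open>d\<close> lies in a copy of \<open>G\<close>, while \<open>T m\<close>
  has room inside \<open>G\<close> for one more left-over vertex. Thus \<open>G\<close> embeds into itself with image missing
  a vertex \<open>y\<close>, a copy of \<open>x\<close>, that sees the image exactly as the image of \<open>d\<close> does. The heart of
  the proof is that in a star-like graph this makes the single vertex \<open>y\<close> removable
  (\<open>twin_of_removed_vertex\<close>). But a removable vertex is a twin of all its images under automorphisms
  (\<open>removable_vertex_twins\<close>), so \<open>y\<close> and \<open>x\<close>, in different copies of \<open>K\<close>, are twins; then the
  vertices of \<open>K - {x}\<close> see \<open>x\<close> just as they see the other copies of \<open>x\<close>, and \<open>K - {x}\<close> would be
  removable after all.
\<close>

section \<open>Embeddings and removable vertex sets\<close>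

definition adj :: "'a graph \<Rightarrow> 'a \<Rightarrow> 'a \<Rightarrow> bool" where
  "adj G u v \<longleftrightarrow> {u, v} \<in> edges G"

definition embedding_on :: "'a graph \<Rightarrow> 'a set \<Rightarrow> ('a \<Rightarrow> 'a) \<Rightarrow> bool" where
  "embedding_on G A e \<longleftrightarrow> inj_on e A \<and> e ` A \<subseteq> verts G \<and>
     (\<forall>u\<in>A. \<forall>v\<in>A. adj G (e u) (e v) \<longleftrightarrow> adj G u v)"

definition removable :: "'a graph \<Rightarrow> 'a set \<Rightarrow> bool" where
  "removable G W \<longleftrightarrow> W \<noteq> {} \<and> W \<subseteq> verts G \<and>
     (\<exists>e. embedding_on G (verts G) e \<and> e ` verts G = verts G - W)"

lemma adj_commute: "adj G u v \<longleftrightarrow> adj G v u"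
  by (simp add: adj_def insert_commute)

lemma not_adj_self: "simple_graph G \<Longrightarrow> \<not> adj G u u"
  by (auto simp: adj_def simple_graph_def dest!: bspec)

lemma embedding_on_adj:
  "embedding_on G A e \<Longrightarrow> u \<in> A \<Longrightarrow> v \<in> A \<Longrightarrow> adj G (e u) (e v) \<longleftrightarrow> adj G u v"
  by (simp add: embedding_on_def)

lemma embedding_on_subset: "embedding_on G A e \<Longrightarrow> B \<subseteq> A \<Longrightarrow> embedding_on G B e"
  by (auto simp: embedding_on_def intro: inj_on_subset)

lemma embedding_on_comp:
  assumes "embedding_on G A e" "embedding_on G B g" "e ` A \<subseteq> B"
  shows "embedding_on G A (g \<circ> e)"
  unfolding embedding_on_def
proof (intro conjI)
  show "inj_on (g \<circ> e) A"
    using assms by (auto simp: embedding_on_def intro!: comp_inj_on inj_on_subset[of g B])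
qed (use assms in \<open>auto simp: embedding_on_def image_subset_iff\<close>)

lemma verts_induce: "A \<subseteq> verts G \<Longrightarrow> verts (induce G A) = A"
  by (auto simp: induce_def)

lemma induce_verts: "simple_graph G \<Longrightarrow> induce G (verts G) = G"
  by (cases G) (auto simp: induce_def simple_graph_def)

lemma induce_induce: "B \<subseteq> A \<Longrightarrow> A \<subseteq> verts G \<Longrightarrow> induce (induce G A) B = induce G B"
  by (auto simp: induce_def)

lemma simple_graph_induce: "simple_graph G \<Longrightarrow> simple_graph (induce G A)"
  by (auto simp: induce_def simple_graph_def)

lemma graph_diff_induce: "W \<subseteq> verts G \<Longrightarrow> graph_diff G (induce G W) = induce G (verts G - W)"
  by (simp add: graph_diff_def verts_induce)

lemma graph_iso_induce_iff:
  assumes "A \<subseteq> verts G" "B \<subseteq> verts G"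
  shows "graph_iso f (induce G A) (induce G B) \<longleftrightarrow> embedding_on G A f \<and> f ` A = B"
proof -
  have *: "verts G \<inter> A = A" "verts G \<inter> B = B" using assms by auto
  show ?thesis
    using assms(2)
    by (auto simp: graph_iso_def induce_def embedding_on_def bij_betw_def adj_def * image_subset_iff)
qed

lemma isomorphic_induce_iff:
  assumes "A \<subseteq> verts G" "B \<subseteq> verts G"
  shows "isomorphic (induce G A) (induce G B) \<longleftrightarrow> (\<exists>f. embedding_on G A f \<and> f ` A = B)"
  using graph_iso_induce_iff[OF assms] by (auto simp: isomorphic_def)

lemma isomorphic_sym:
  assumes "isomorphic A B"
  shows "isomorphic B A"
proof -
  obtain f where f: "graph_iso f A B" using assms by (auto simp: isomorphic_def)
  let ?g = "inv_into (verts A) f"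
  have bij: "bij_betw f (verts A) (verts B)" using f by (simp add: graph_iso_def)
  have "f (?g u) = u" "?g u \<in> verts A" if "u \<in> verts B" for u
    using bij that by (auto simp: bij_betw_def f_inv_into_f inv_into_into)
  then have "graph_iso ?g B A"
    using f bij_betw_inv_into[OF bij] by (simp add: graph_iso_def)
  then show ?thesis by (auto simp: isomorphic_def)
qed

lemma isomorphic_trans:
  assumes "isomorphic A B" "isomorphic B C"
  shows "isomorphic A C"
proof -
  obtain f g where f: "graph_iso f A B" and g: "graph_iso g B C"
    using assms by (auto simp: isomorphic_def)
  have "f u \<in> verts B" if "u \<in> verts A" for u
    using f that by (auto simp: graph_iso_def bij_betw_def)
  then have "graph_iso (g \<circ> f) A C"
    using f g by (auto simp: graph_iso_def intro: bij_betw_trans)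
  then show ?thesis by (auto simp: isomorphic_def)
qed

lemma removable_iff_isomorphic:
  assumes "simple_graph G" "W \<subseteq> verts G"
  shows "removable G W \<longleftrightarrow> W \<noteq> {} \<and> isomorphic (induce G (verts G - W)) G"
proof -
  have "isomorphic (induce G (verts G - W)) (induce G (verts G)) \<longleftrightarrow>
      isomorphic (induce G (verts G)) (induce G (verts G - W))"
    using isomorphic_sym by auto
  also have "\<dots> \<longleftrightarrow> (\<exists>e. embedding_on G (verts G) e \<and> e ` verts G = verts G - W)"
    by (simp add: isomorphic_induce_iff)
  finally show ?thesis
    using assms by (simp add: removable_def induce_verts)
qed

lemma removable_iff_Rem:
  assumes "simple_graph G" "verts G \<noteq> {}" "W \<subseteq> verts G"
  shows "removable G W \<longleftrightarrow> induce G W \<in> Rem G"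
proof -
  have "induce G W \<noteq> G" if "isomorphic (induce G (verts G - W)) G"
  proof
    assume "induce G W = G"
    then have "W = verts G" using verts_induce[OF assms(3)] by simp
    with that have "isomorphic (induce G {}) G" by simp
    then show False
      using assms(2) by (auto simp: isomorphic_def graph_iso_def induce_def bij_betw_def)
  qed
  then show ?thesis
    using assms
    by (auto simp: Rem_def removable_iff_isomorphic verts_induce graph_diff_induce
        proper_induced_subgraph_def induced_subgraph_def)
qed

text \<open>
  Well-manneredness in terms of vertex sets. The maps \<open>\<alpha>\<close> and \<open>e\<close> send \<open>W\<close> to the same set but
  may differ on its vertices; therefore labels of the vertices in \<open>e ` W\<close> have to be taken from
  \<open>\<alpha>\<close>, not from \<open>e\<close>.
\<close>

lemma star_like_swap:
  assumes "star_like G" "embedding_on G (verts G) e" "e ` verts G = verts G - W"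
    "W \<noteq> {}" "W \<subseteq> verts G"
  obtains \<alpha> where "embedding_on G (verts G) \<alpha>" "\<alpha> ` verts G = verts G" "\<alpha> ` W = e ` W"
    "\<alpha> ` e ` W = W" "\<And>v. v \<in> verts G \<Longrightarrow> v \<notin> W \<Longrightarrow> v \<notin> e ` W \<Longrightarrow> \<alpha> v = v"
proof -
  have G: "simple_graph G" "verts G \<noteq> {}"
    using assms(1) by (auto simp: star_like_def self_contained_def)
  let ?H = "induce G W"
  have "removable G W" using assms(2-5) unfolding removable_def by blast
  then have "well_mannered G ?H"
    using assms(1,5) G removable_iff_Rem[of G W] by (auto simp: star_like_def)
  moreover have "graph_iso e (induce G (verts G)) (induce G (verts G - W))"
    using assms(2,3) graph_iso_induce_iff[of "verts G" G "verts G - W"] by auto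
  then have "e \<in> Iso G ?H"
    using assms(5) G by (simp add: Iso_def graph_diff_induce induce_verts)
  ultimately obtain \<alpha> where "\<alpha> \<in> Aut G" and
    im: "image_graph e ?H = image_graph \<alpha> ?H" "image_graph (\<alpha> \<circ> \<alpha>) ?H = ?H" and
    fixed: "\<forall>v\<in>verts G. v \<notin> verts ?H \<union> verts (image_graph e ?H) \<longrightarrow> \<alpha> v = v"
    unfolding well_mannered_def by blast
  then have "graph_iso \<alpha> (induce G (verts G)) (induce G (verts G))"
    using G by (simp add: Aut_def induce_verts)
  then have "embedding_on G (verts G) \<alpha>" "\<alpha> ` verts G = verts G"
    using graph_iso_induce_iff[of "verts G" G "verts G"] by auto
  moreover have "\<alpha> ` W = e ` W" "\<alpha> ` \<alpha> ` W = W"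
    using im(1)[THEN arg_cong[where f = verts]] im(2)[THEN arg_cong[where f = verts]] assms(5)
    unfolding image_graph_def by (simp_all add: verts_induce image_comp)
  moreover have "\<alpha> v = v" if "v \<in> verts G" "v \<notin> W" "v \<notin> e ` W" for v
    using fixed that assms(5) by (simp add: image_graph_def verts_induce)
  ultimately show ?thesis by (intro that[of \<alpha>]) (simp_all add: image_comp)
qed

section \<open>Families of interchangeable copies\<close>

text \<open>
  The maps \<open>s n\<close> label the vertices of the \<open>n\<close>-th copy by those of \<open>K\<close>, the copy number \<open>0\<close>.
  The last two assumptions amount to saying that every permutation of the index set induces an
  automorphism of \<open>G\<close> that preserves labels and fixes the vertices outside the copies.
\<close>

locale interchangeable_copies =
  fixes G :: "'a graph" and K :: "'a set" and s :: "nat \<Rightarrow> 'a \<Rightarrow> 'a"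
  assumes simple: "simple_graph G"
    and copy_subset: "s n ` K \<subseteq> verts G"
    and copy_inj: "inj_on (s n) K"
    and copy_0: "k \<in> K \<Longrightarrow> s 0 k = k"
    and copies_disjoint: "n \<noteq> m \<Longrightarrow> s n ` K \<inter> s m ` K = {}"
    and adj_inside: "k \<in> K \<Longrightarrow> l \<in> K \<Longrightarrow> adj G (s n k) (s n l) \<longleftrightarrow> adj G k l"
    and adj_outside: "k \<in> K \<Longrightarrow> z \<in> verts G \<Longrightarrow> z \<notin> s n ` K \<Longrightarrow> z \<notin> s m ` K \<Longrightarrow>
      adj G z (s n k) \<longleftrightarrow> adj G z (s m k)"
begin

lemma copy_in_verts [simp]: "k \<in> K \<Longrightarrow> s n k \<in> verts G"
  using copy_subset by blast

lemma original_subset: "K \<subseteq> verts G"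
  using copy_subset[of 0] copy_0 by simp

lemma copy_eq_iff [simp]: "k \<in> K \<Longrightarrow> l \<in> K \<Longrightarrow> s n k = s m l \<longleftrightarrow> n = m \<and> k = l"
  using copies_disjoint[of n m] copy_inj[of n] by (auto dest: inj_onD)

lemma copy_notin [simp]: "k \<in> K \<Longrightarrow> s n k \<in> s m ` K \<longleftrightarrow> n = m"
  by auto

lemma copy_0_image: "s 0 ` K = K"
  using copy_0 by simp

lemma copy_in_original_iff: "k \<in> K \<Longrightarrow> s n k \<in> K \<longleftrightarrow> n = 0"
  using copy_notin[of k n 0] by (simp only: copy_0_image)

text \<open>
  The end points can be moved one at a time as long as they never meet in the same copy; a detour
  through a fresh copy \<open>l\<close> ensures that.
\<close>

lemma adj_across:
  assumes "a \<in> K" "b \<in> K" "i \<noteq> j" "i' \<noteq> j'"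
  shows "adj G (s i a) (s j b) \<longleftrightarrow> adj G (s i' a) (s j' b)"
proof -
  obtain l where l: "l \<notin> {i, j, i', j'}"
    using ex_new_if_finite[of "{i, j, i', j'}"] by auto
  have "adj G (s i a) (s j b) \<longleftrightarrow> adj G (s i a) (s l b)"
    using assms l by (intro adj_outside) auto
  also have "\<dots> \<longleftrightarrow> adj G (s l b) (s i a)" by (rule adj_commute)
  also have "\<dots> \<longleftrightarrow> adj G (s l b) (s i' a)"
    using assms l by (intro adj_outside) auto
  also have "\<dots> \<longleftrightarrow> adj G (s i' a) (s l b)" by (rule adj_commute)
  also have "\<dots> \<longleftrightarrow> adj G (s i' a) (s j' b)"
    using assms l by (intro adj_outside) auto
  finally show ?thesis .
qed

lemma adj_outside_commute:
  "k \<in> K \<Longrightarrow> z \<in> verts G \<Longrightarrow> z \<notin> s n ` K \<Longrightarrow> z \<notin> s m ` K \<Longrightarrow>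
      adj G (s n k) z \<longleftrightarrow> adj G (s m k) z"
  using adj_outside[of k z n m] by (simp add: adj_commute)

lemma subfamily:
  assumes "inj \<pi>" "\<pi> 0 = 0"
  shows "interchangeable_copies G K (s \<circ> \<pi>)"
proof
  show "(s \<circ> \<pi>) n ` K \<inter> (s \<circ> \<pi>) m ` K = {}" if "n \<noteq> m" for n m
    using that copies_disjoint[of "\<pi> n" "\<pi> m"] assms by (auto dest: injD)
  show "adj G z ((s \<circ> \<pi>) n k) \<longleftrightarrow> adj G z ((s \<circ> \<pi>) m k)"
    if "k \<in> K" "z \<in> verts G" "z \<notin> (s \<circ> \<pi>) n ` K" "z \<notin> (s \<circ> \<pi>) m ` K" for k z n m
    using that adj_outside[of k z "\<pi> n" "\<pi> m"] by simp
qed (simp_all add: assms simple copy_subset copy_inj copy_0 adj_inside)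

text \<open>
  Since the copies are disjoint and each is labelled injectively, index and label of a vertex in a
  copy are unique, so that the choices in the body are determined.
\<close>

definition shift :: "(nat \<Rightarrow> nat) \<Rightarrow> 'a \<Rightarrow> 'a" where
  "shift \<pi> v = (if \<exists>n. v \<in> s n ` K then
     (let n = SOME n. v \<in> s n ` K in s (\<pi> n) (inv_into K (s n) v)) else v)"

lemma shift_copy [simp]: "k \<in> K \<Longrightarrow> shift \<pi> (s n k) = s (\<pi> n) k"
  by (auto simp: shift_def copy_inj)

lemma shift_outside: "\<forall>n. v \<notin> s n ` K \<Longrightarrow> shift \<pi> v = v"
  by (simp add: shift_def)

lemma shift_embedding:
  assumes "inj \<pi>"
  shows "embedding_on G (verts G) (shift \<pi>)"
    and "shift \<pi> ` verts G = verts G - (\<Union>n\<in>- range \<pi>. s n ` K)"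
proof -
  have cases: "(\<exists>n k. k \<in> K \<and> v = s n k) \<or> (\<forall>n. v \<notin> s n ` K)" for v
    by blast
  have out: "adj G (s n k) v \<longleftrightarrow> adj G (s m k) v" "adj G v (s n k) \<longleftrightarrow> adj G v (s m k)"
    if "k \<in> K" "\<forall>n. v \<notin> s n ` K" "v \<in> verts G" for n m k v
    using adj_outside[of k v n m] adj_outside_commute[of k v n m] that by auto
  have \<pi>_eq: "\<pi> n = \<pi> m \<longleftrightarrow> n = m" for n m
    using assms by (rule inj_eq)
  have inj: "shift \<pi> u = shift \<pi> v \<Longrightarrow> u = v" for u v
    using cases[of u] cases[of v] by (elim disjE exE conjE) (auto simp: shift_outside \<pi>_eq)
  have adj: "adj G (shift \<pi> u) (shift \<pi> v) \<longleftrightarrow> adj G u v" if uv: "u \<in> verts G" "v \<in> verts G" for u v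
    using cases[of u]
  proof
    assume "\<exists>n k. k \<in> K \<and> u = s n k"
    then obtain n k where u: "k \<in> K" "u = s n k" by blast
    show ?thesis using cases[of v]
    proof
      assume "\<exists>n k. k \<in> K \<and> v = s n k"
      then obtain m l where v: "l \<in> K" "v = s m l" by blast
      show ?thesis
      proof (cases "n = m")
        case True
        then show ?thesis using u v by (simp add: adj_inside)
      next
        case False
        then have "\<pi> n \<noteq> \<pi> m" using assms by (auto dest: injD)
        then show ?thesis using u v False adj_across[of k l "\<pi> n" "\<pi> m" n m] by simp
      qed
    next
      assume "\<forall>n. v \<notin> s n ` K"
      then show ?thesis using u uv out by (simp add: shift_outside)
    qed
  next
    assume u: "\<forall>n. u \<notin> s n ` K"
    from cases[of v] show ?thesis
    proof
      assume "\<exists>n k. k \<in> K \<and> v = s n k"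
      then obtain m l where "l \<in> K" "v = s m l" by blast
      then show ?thesis using u uv out(2)[of l u "\<pi> m" m] by (simp add: shift_outside)
    qed (use u in \<open>simp add: shift_outside\<close>)
  qed
  have "shift \<pi> ` verts G \<subseteq> verts G"
  proof
    fix w assume "w \<in> shift \<pi> ` verts G"
    then obtain v where v: "v \<in> verts G" "w = shift \<pi> v" by blast
    from cases[of v] show "w \<in> verts G"
    proof
      assume "\<exists>n k. k \<in> K \<and> v = s n k"
      then show ?thesis using v(2) by auto
    qed (simp add: v shift_outside)
  qed
  then show "embedding_on G (verts G) (shift \<pi>)"
    unfolding embedding_on_def using adj by (blast intro: inj_onI inj)
  show "shift \<pi> ` verts G = verts G - (\<Union>n\<in>- range \<pi>. s n ` K)" (is "?L = ?R")
  proof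
    show "?L \<subseteq> ?R"
    proof
      fix w assume "w \<in> ?L"
      then obtain v where v: "v \<in> verts G" "w = shift \<pi> v" by blast
      then show "w \<in> ?R" using cases[of v] by (auto simp: shift_outside)
    qed
    show "?R \<subseteq> ?L"
    proof
      fix w assume w: "w \<in> ?R"
      show "w \<in> ?L" using cases[of w]
      proof
        assume "\<exists>n k. k \<in> K \<and> w = s n k"
        then obtain n k where k: "k \<in> K" "w = s n k" by blast
        with w obtain m where "n = \<pi> m" by auto
        with k have "w = shift \<pi> (s m k)" by simp
        moreover have "s m k \<in> verts G" using k(1) by simp
        ultimately show ?thesis by (rule image_eqI)
      next
        assume "\<forall>n. w \<notin> s n ` K"
        then have "w = shift \<pi> w" by (simp add: shift_outside)
        then show ?thesis using w by blast
      qed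
    qed
  qed
qed

lemma original_removable:
  assumes "K \<noteq> {}"
  shows "removable G K"
proof -
  have "- range Suc = {0}" by (auto simp: image_iff) (metis not0_implies_Suc)
  then have "shift Suc ` verts G = verts G - K"
    using shift_embedding(2)[of Suc] copy_0 by simp
  then show ?thesis
    using shift_embedding(1)[of Suc] assms original_subset by (auto simp: removable_def)
qed

text \<open>
  If \<open>C\<close> sees the rest of its own copy just as it sees the other copies, then the index of
  \<open>C\<close> can be changed independently of that of the rest.
\<close>

lemma copies_of_part:
  assumes "C \<subseteq> K"
    and sep: "\<And>c k. c \<in> C \<Longrightarrow> k \<in> K - C \<Longrightarrow> adj G c k \<longleftrightarrow> adj G c (s 1 k)"
  shows "interchangeable_copies G C s"
proof
  show "s n ` C \<inter> s m ` C = {}" if "n \<noteq> m" for n m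
    using copies_disjoint[OF that] assms(1) by blast
  show "adj G z (s n c) \<longleftrightarrow> adj G z (s m c)"
    if c: "c \<in> C" and z: "z \<in> verts G" "z \<notin> s n ` C" "z \<notin> s m ` C" for c z n m
  proof -
    have "c \<in> K" using c assms(1) by auto
    have *: "adj G (s i k) (s j c) \<longleftrightarrow> adj G (s 1 k) c" if k: "k \<in> K - C" for k i j
    proof (cases "i = j")
      case True
      then show ?thesis using sep[OF c k] k \<open>c \<in> K\<close> by (simp add: adj_inside adj_commute[of G _ c])
    next
      case False
      then show ?thesis using adj_across[of k c i j 1 0] k \<open>c \<in> K\<close> by (simp add: copy_0)
    qed
    show ?thesis
    proof (cases "\<exists>i. \<exists>k\<in>K. z = s i k \<and> k \<notin> C")
      case True
      then show ?thesis using * by auto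
    next
      case False
      then have "z \<notin> s n ` K" "z \<notin> s m ` K" using z by blast+
      then show ?thesis using adj_outside[OF \<open>c \<in> K\<close> z(1)] by blast
    qed
  qed
  show "inj_on (s n) C" for n using copy_inj assms(1) by (rule inj_on_subset)
  show "s n ` C \<subseteq> verts G" for n using copy_subset[of n] assms(1) by blast
  show "adj G (s n k) (s n l) \<longleftrightarrow> adj G k l" if "k \<in> C" "l \<in> C" for k l n
    using that assms(1) by (intro adj_inside) blast+
  show "s 0 k = k" if "k \<in> C" for k using that assms(1) copy_0 by blast
qed (rule simple)

end

text \<open>
  If an automorphism \<open>\<beta>\<close> carries \<open>K\<close> to \<open>e\<^sup>n(K)\<close>, then \<open>e \<circ> \<beta>\<close> is another isomorphism onto
  the graph without \<open>K\<close>, and it carries \<open>K\<close> to \<open>e\<^sup>n\<^sup>+\<^sup>1(K)\<close>; well-manneredness of \<open>K\<close> with respect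
  to \<open>e \<circ> \<beta>\<close> supplies the next automorphism, which in addition fixes all other vertices.
\<close>

lemma star_like_copies:
  assumes "star_like G" "removable G K"
  obtains s where "interchangeable_copies G K s"
proof -
  have G: "simple_graph G" using assms(1) by (simp add: star_like_def self_contained_def)
  obtain e where e: "embedding_on G (verts G) e" "e ` verts G = verts G - K"
    and K: "K \<noteq> {}" "K \<subseteq> verts G"
    using assms(2) by (auto simp: removable_def)
  define H where "H n = (e ^^ n) ` K" for n
  have H_Suc: "H (Suc n) = e ` H n" for n by (simp add: H_def image_comp)
  have emb: "embedding_on G (verts G) (e ^^ n)" for n
  proof (induction n)
    case (Suc n)
    then have "embedding_on G (verts G) (e \<circ> (e ^^ n))"
      using e(1) by (rule embedding_on_comp) (use Suc in \<open>auto simp: embedding_on_def\<close>)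
    then show ?case by (simp only: funpow.simps)
  qed (simp add: embedding_on_def)
  have H_sub: "H n \<subseteq> verts G" for n
    using emb[of n] K(2) by (auto simp: H_def embedding_on_def)
  have disj_less: "H n \<inter> H m = {}" if less: "n < m" for n m
  proof -
    obtain d where m: "m = n + Suc d" using less_imp_Suc_add[OF less] by auto
    have "H m = (e ^^ n) ` H (Suc d)"
      by (simp only: H_def m funpow_add image_comp)
    then have "H m = (e ^^ n) ` e ` H d" by (simp only: H_Suc)
    moreover have "e ` H d \<inter> K = {}" "e ` H d \<subseteq> verts G" using e(2) H_sub[of d] by blast+
    ultimately show ?thesis
      using inj_on_image_Int[of "e ^^ n" "verts G" K "e ` H d"] emb[of n] K(2)
      unfolding H_def[of n] embedding_on_def by (simp add: Int_commute)
  qed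
  then have disj: "H n \<inter> H m = {}" if "n \<noteq> m" for n m
    using that by (metis inf_commute linorder_neqE_nat)
  have "\<exists>\<beta>. embedding_on G (verts G) \<beta> \<and> \<beta> ` verts G = verts G \<and> \<beta> ` K = H n \<and>
      (\<forall>v\<in>verts G. v \<notin> K \<longrightarrow> v \<notin> H n \<longrightarrow> \<beta> v = v)" for n
  proof (induction n)
    case 0
    show ?case by (rule exI[of _ id]) (simp add: embedding_on_def H_def)
  next
    case (Suc n)
    then obtain \<beta> where \<beta>: "embedding_on G (verts G) \<beta>" "\<beta> ` verts G = verts G" "\<beta> ` K = H n"
      by blast
    have "embedding_on G (verts G) (e \<circ> \<beta>)" "(e \<circ> \<beta>) ` verts G = verts G - K"
      and im: "(e \<circ> \<beta>) ` K = H (Suc n)"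
      using embedding_on_comp[OF \<beta>(1) e(1)] \<beta>(2) e(2)
      by (simp_all only: image_comp[symmetric] \<beta>(3) H_Suc order_refl)
    from star_like_swap[OF assms(1) this(1,2) K] obtain \<alpha> where
      "embedding_on G (verts G) \<alpha>" "\<alpha> ` verts G = verts G" "\<alpha> ` K = (e \<circ> \<beta>) ` K"
      "\<And>v. v \<in> verts G \<Longrightarrow> v \<notin> K \<Longrightarrow> v \<notin> (e \<circ> \<beta>) ` K \<Longrightarrow> \<alpha> v = v"
      by metis
    then show ?case unfolding im by blast
  qed
  then obtain \<beta> where \<beta>: "\<And>n. embedding_on G (verts G) (\<beta> n)" "\<And>n. \<beta> n ` K = H n"
    "\<And>n v. v \<in> verts G \<Longrightarrow> v \<notin> K \<Longrightarrow> v \<notin> H n \<Longrightarrow> \<beta> n v = v"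
    by metis
  define s where "s n = (if n = 0 then id else \<beta> n)" for n
  have s_im: "s n ` K = H n" for n by (simp add: s_def \<beta>(2)) (simp add: H_def)
  have s_emb: "embedding_on G (verts G) (s n)" for n
    using \<beta>(1) by (simp add: s_def) (simp add: embedding_on_def)
  have s_in: "s n k \<in> H n" if "k \<in> K" for n k using that s_im by blast
  have s_fix: "s n v = v" if "v \<in> verts G" "v \<notin> K" "v \<notin> H n" for n v
    using that \<beta>(3) by (simp add: s_def)
  have base: "adj G z (s n k) \<longleftrightarrow> adj G z k"
    if "k \<in> K" "z \<in> verts G" "z \<notin> K" "z \<notin> H n" for z n k
    using embedding_on_adj[OF s_emb[of n], of z k] that s_fix K(2) by auto
  have H0: "H 0 = K" by (simp add: H_def)
  have "interchangeable_copies G K s"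
  proof
    show "adj G z (s n k) \<longleftrightarrow> adj G z (s m k)"
      if k: "k \<in> K" and z: "z \<in> verts G" "z \<notin> s n ` K" "z \<notin> s m ` K" for k z n m
    proof (cases "z \<in> K")
      case False
      then show ?thesis using base[of k z n] base[of k z m] k z by (simp add: s_im)
    next
      case True
      then have nm: "n \<noteq> 0" "m \<noteq> 0" using z by (auto simp: s_def intro!: Nat.gr0I)
      \<comment> \<open>A vertex of \<open>K\<close> itself is first moved into a third copy, away from \<open>K\<close>.\<close>
      obtain r where r: "r \<notin> {0, n, m}" using ex_new_if_finite[of "{0, n, m}"] by auto
      have notin: "s j k \<notin> K" "s j k \<notin> H r" "s j k \<in> verts G" if "j \<in> {n, m}" for j
        using that nm r s_in[OF k, of j] disj[of j 0] disj[of j r] H_sub[of j] H0 by auto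
      have "s r z \<in> H r" using s_in True by blast
      then have sr: "s r z \<in> verts G" "s r z \<notin> K" "s r z \<notin> H n" "s r z \<notin> H m"
        using H_sub[of r] disj[of r 0] disj[of r n] disj[of r m] r H0 by auto
      have move: "adj G z (s j k) \<longleftrightarrow> adj G (s r z) (s j k)" if "j \<in> {n, m}" for j
        using base[of z "s j k" r] notin[OF that] True by (simp add: adj_commute)
      show ?thesis
        using move[of n] move[of m] base[of k "s r z" n] base[of k "s r z" m] sr k by simp
    qed
    show "inj_on (s n) K" "s n ` K \<subseteq> verts G" for n
      using s_emb[of n] K(2) by (auto simp: embedding_on_def intro: inj_on_subset)
    show "adj G (s n k) (s n l) \<longleftrightarrow> adj G k l" if "k \<in> K" "l \<in> K" for n k l
      using embedding_on_adj[OF s_emb] that K(2) by auto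
    show "s n ` K \<inter> s m ` K = {}" if "n \<noteq> m" for n m
      using disj[OF that] by (simp add: s_im)
  qed (use G in \<open>simp_all add: s_def\<close>)
  then show ?thesis using that by blast
qed

section \<open>Twins of removed vertices\<close>

context interchangeable_copies
begin

text \<open>
  The vertex \<open>d\<close> can stand in for \<open>x\<close>: shift all copies by one and send \<open>d\<close> to \<open>x\<close>. The
  embedding \<open>e\<close> so obtained removes \<open>?K' = {d} \<union> (K - {x})\<close> and moves it to \<open>x\<close> together with the
  first shifted copy of \<open>K - {x}\<close>. The automorphism \<open>\<alpha>\<close> that swaps these two sets fixes all
  copies of \<open>x\<close> except \<open>x\<close>. For \<open>y\<close> in \<open>K - {x}\<close> it sends \<open>s 1 y\<close> into \<open>?K'\<close>, whose vertices cannot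
  tell \<open>s 1 x\<close> from \<open>s 2 x\<close>. Hence neither can \<open>s 1 y\<close>: the vertex \<open>x\<close> sees its own copy of \<open>y\<close> as
  it sees the others.
\<close>

lemma outside_twin_imp_removable:
  assumes "star_like G" "x \<in> K" "d \<in> verts G" "\<forall>n. d \<notin> s n ` K"
    and twin: "\<And>z. z \<in> verts G - K \<Longrightarrow> z \<noteq> d \<Longrightarrow> adj G z d \<longleftrightarrow> adj G z x"
  shows "removable G {x}"
proof -
  define e where "e = (shift Suc)(d := x)"
  let ?K' = "insert d (K - {x})"
  have rng: "- range Suc = {0}" by (auto simp: image_iff) (metis not0_implies_Suc)
  have shift: "embedding_on G (verts G) (shift Suc)" "shift Suc ` verts G = verts G - K"
    using shift_embedding[of Suc] by (simp_all add: rng copy_0)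
  have d: "d \<notin> K" "shift Suc d = d"
    using assms(4)[rule_format, of 0] by (simp_all add: copy_0 shift_outside assms(4))
  have d_adj: "adj G (shift Suc v) x \<longleftrightarrow> adj G v d" if v: "v \<in> verts G" "v \<noteq> d" for v
  proof (cases "\<exists>n. v \<in> s n ` K")
    case True
    then obtain n k where k: "k \<in> K" "v = s n k" by blast
    have "adj G v d \<longleftrightarrow> adj G (s (Suc n) k) d"
      unfolding k(2) using assms(3,4) k(1) by (intro adj_outside_commute) blast+
    also have "\<dots> \<longleftrightarrow> adj G (s (Suc n) k) x"
    proof (rule twin)
      show "s (Suc n) k \<in> verts G - K" using k(1) by (simp add: copy_in_original_iff)
      show "s (Suc n) k \<noteq> d" using assms(4) k(1) by blast
    qed
    finally show ?thesis using k by simp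
  next
    case False
    then have "v \<notin> K" using copy_0_image by blast
    then show ?thesis using twin[of v] v False by (simp add: shift_outside)
  qed
  have e_emb: "embedding_on G (verts G) e"
    unfolding embedding_on_def
  proof (intro conjI ballI)
    show "inj_on e (verts G)"
      using shift assms(2) unfolding e_def embedding_on_def by (intro inj_on_fun_updI) auto
    show "e ` verts G \<subseteq> verts G"
      using shift assms(2) original_subset by (auto simp: e_def)
    show "adj G (e u) (e v) \<longleftrightarrow> adj G u v" if uv: "u \<in> verts G" "v \<in> verts G" for u v
    proof (cases "u = d \<or> v = d")
      case True
      then show ?thesis
        using d_adj[of u] d_adj[of v] uv not_adj_self[OF simple]
        by (auto simp: e_def adj_commute[of G x] adj_commute[of G d])
    next
      case False
      then show ?thesis using embedding_on_adj[OF shift(1) uv] by (simp add: e_def)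
    qed
  qed
  have "shift Suc ` (verts G - {d}) = verts G - K - {d}"
    using inj_on_image_set_diff[of "shift Suc" "verts G" "verts G" "{d}"] shift d assms(3)
    by (simp add: embedding_on_def)
  moreover have "e ` verts G = insert x (shift Suc ` (verts G - {d}))"
    using assms(3) by (auto simp: e_def image_iff)
  ultimately have e_im: "e ` verts G = verts G - ?K'"
    using assms(2) original_subset d by auto
  have e_K': "e ` ?K' = insert x (s 1 ` (K - {x}))"
  proof -
    have "e k = s 1 k" if "k \<in> K" for k
      using that d shift_copy[of k Suc 0] by (auto simp: e_def copy_0)
    then have "e ` (K - {x}) = s 1 ` (K - {x})" by (intro image_cong) auto
    moreover have "e d = x" by (simp add: e_def)
    ultimately show ?thesis by (simp only: image_insert)
  qed
  have "?K' \<noteq> {}" "?K' \<subseteq> verts G" using assms(3) original_subset by auto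
  from star_like_swap[OF assms(1) e_emb e_im this] obtain \<alpha> where
    \<alpha>: "embedding_on G (verts G) \<alpha>" "\<alpha> ` e ` ?K' = ?K'"
      "\<And>v. v \<in> verts G \<Longrightarrow> v \<notin> ?K' \<Longrightarrow> v \<notin> e ` ?K' \<Longrightarrow> \<alpha> v = v"
    by metis
  have not_K: "s n k \<notin> K" if "k \<in> K" "n \<noteq> 0" for n k
    using that by (simp add: copy_in_original_iff)
  have \<alpha>_fix: "\<alpha> (s n x) = s n x" if "n \<noteq> 0" for n
  proof (rule \<alpha>(3))
    show "s n x \<notin> ?K'" using not_K[OF assms(2) that] assms(2,4) by auto
    show "s n x \<notin> e ` ?K'"
      unfolding e_K' using not_K[OF assms(2) that] assms(2) by auto
  qed (use assms(2) in simp)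
  have "adj G x y \<longleftrightarrow> adj G x (s 1 y)" if y: "y \<in> K - {x}" for y
  proof -
    have "\<alpha> (s 1 y) \<in> ?K'" using \<alpha>(2) y unfolding e_K' by blast
    then have w: "\<alpha> (s 1 y) \<in> verts G" "\<alpha> (s 1 y) \<notin> s n ` K" if "n \<noteq> 0" for n
      using that assms(3,4) original_subset not_K by auto
    have step: "adj G (s n x) (s 1 y) \<longleftrightarrow> adj G (s n x) (\<alpha> (s 1 y))" if "n \<noteq> 0" for n
      using embedding_on_adj[OF \<alpha>(1), of "s n x" "s 1 y"] \<alpha>_fix[OF that] y assms(2) by simp
    have "adj G x y \<longleftrightarrow> adj G (s 1 x) (s 1 y)" using y assms(2) by (simp add: adj_inside)
    also have "\<dots> \<longleftrightarrow> adj G (s 1 x) (\<alpha> (s 1 y))" using step by simp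
    also have "\<dots> \<longleftrightarrow> adj G (s 2 x) (\<alpha> (s 1 y))"
      using w[of 1] w[of 2] assms(2) by (intro adj_outside_commute) auto
    also have "\<dots> \<longleftrightarrow> adj G (s 2 x) (s 1 y)" using step by simp
    also have "\<dots> \<longleftrightarrow> adj G (s 0 x) (s 1 y)" using y assms(2) by (intro adj_across) auto
    finally show ?thesis using assms(2) by (simp add: copy_0)
  qed
  then have "interchangeable_copies G {x} s"
    using assms(2) by (intro copies_of_part) auto
  then show ?thesis by (rule interchangeable_copies.original_removable) simp
qed

end

text \<open>
  Here \<open>d\<close> may belong to a copy of \<open>L\<close>; that copy, which is not \<open>L\<close> itself, is dropped from the
  family.
\<close>

lemma twin_of_removed_vertex:
  assumes "star_like G" "removable G L" "x \<in> L" "d \<in> verts G - L"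
    and twin: "\<And>z. z \<in> verts G - L \<Longrightarrow> z \<noteq> d \<Longrightarrow> adj G z d \<longleftrightarrow> adj G z x"
  shows "removable G {x}"
proof -
  obtain s where "interchangeable_copies G L s" using star_like_copies assms(1,2) by blast
  then interpret interchangeable_copies G L s .
  have d0: "d \<notin> s 0 ` L" using assms(4) by (simp add: copy_0_image)
  obtain j where "j \<noteq> 0" and j: "\<And>n. n \<noteq> j \<Longrightarrow> d \<notin> s n ` L"
  proof (cases "\<exists>j. d \<in> s j ` L")
    case True
    then obtain j where j: "d \<in> s j ` L" by blast
    with d0 have "j \<noteq> 0" by auto
    moreover have "d \<notin> s n ` L" if "n \<noteq> j" for n using copies_disjoint[OF that] j by blast
    ultimately show ?thesis using that by blast
  next
    case False
    then show ?thesis using that[of 1] by simp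
  qed
  define \<pi> where "\<pi> n = (if n < j then n else Suc n)" for n
  have "inj \<pi>" "\<pi> 0 = 0" "\<And>n. \<pi> n \<noteq> j"
    using \<open>j \<noteq> 0\<close> by (auto simp: \<pi>_def inj_def split: if_splits)
  then have "interchangeable_copies G L (s \<circ> \<pi>)" "\<forall>n. d \<notin> (s \<circ> \<pi>) n ` L"
    using subfamily j by auto
  then show ?thesis
    using interchangeable_copies.outside_twin_imp_removable[of G L "s \<circ> \<pi>" x d] assms by blast
qed

text \<open>
  Let \<open>f\<close> be an isomorphism onto the graph without \<open>x\<close>. So is \<open>f \<circ> \<beta>\<close>, and well-manneredness
  makes \<open>x\<close> a twin of \<open>f x\<close> and of \<open>f (\<beta> x)\<close>. Thus these two images are twins of each other, and
  \<open>f\<close> reflects this to \<open>x\<close> and \<open>\<beta> x\<close>.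
\<close>

lemma removable_vertex_twins:
  assumes "star_like G" "removable G {x}"
    "embedding_on G (verts G) \<beta>" "\<beta> ` verts G = verts G"
    and z: "z \<in> verts G" "z \<noteq> x" "z \<noteq> \<beta> x"
  shows "adj G z (\<beta> x) \<longleftrightarrow> adj G z x"
proof -
  obtain f where f: "embedding_on G (verts G) f" "f ` verts G = verts G - {x}"
    and x: "{x} \<noteq> {}" "{x} \<subseteq> verts G"
    using assms(2) by (auto simp: removable_def)
  have moved: "adj G v (g x) \<longleftrightarrow> adj G v x"
    if g: "embedding_on G (verts G) g" "g ` verts G = verts G - {x}"
      and v: "v \<in> verts G" "v \<noteq> x" "v \<noteq> g x" for g v
  proof -
    obtain \<alpha> where "embedding_on G (verts G) \<alpha>" "\<alpha> ` {x} = g ` {x}"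
      "\<And>v. v \<in> verts G \<Longrightarrow> v \<notin> {x} \<Longrightarrow> v \<notin> g ` {x} \<Longrightarrow> \<alpha> v = v"
      using star_like_swap[OF assms(1) g x] by metis
    then show ?thesis using embedding_on_adj[of G "verts G" \<alpha> v x] v x by auto
  qed
  have xV: "x \<in> verts G" "\<beta> x \<in> verts G" using x assms(4) by auto
  have f\<beta>: "embedding_on G (verts G) (f \<circ> \<beta>)" "(f \<circ> \<beta>) ` verts G = verts G - {x}"
    using embedding_on_comp[OF assms(3) f(1)] assms(4) f(2) image_comp[of f \<beta> "verts G"] by auto
  have "f z \<noteq> x" "f z \<in> verts G" using f(2) z by auto
  moreover have "f z \<noteq> f x" "f z \<noteq> f (\<beta> x)"
    using f(1) z xV by (auto simp: embedding_on_def dest: inj_onD)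
  ultimately have "adj G (f z) (f (\<beta> x)) \<longleftrightarrow> adj G (f z) (f x)"
    using moved[OF f, of "f z"] moved[OF f\<beta>, of "f z"] by simp
  then show ?thesis using embedding_on_adj[OF f(1)] z xV by simp
qed

section \<open>Truncating copies\<close>

context interchangeable_copies
begin

definition truncated :: "'a \<Rightarrow> nat \<Rightarrow> 'a set" where
  "truncated x n = verts G - (\<Union>i<n. s i ` (K - {x}))"

lemma copy_in_truncated: "x \<in> K \<Longrightarrow> s i x \<in> truncated x n"
  by (auto simp: truncated_def)

lemma shift_past:
  "embedding_on G (verts G) (shift (\<lambda>j. j + n))"
  "shift (\<lambda>j. j + n) ` verts G = verts G - (\<Union>i<n. s i ` K)"
proof -
  have "inj (\<lambda>j. j + n)" by (simp add: inj_def)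
  moreover have "- range (\<lambda>j. j + n) = {..<n}"
  proof (intro set_eqI iffI)
    fix i assume i: "i \<in> - range (\<lambda>j. j + n)"
    show "i \<in> {..<n}"
    proof (rule ccontr)
      assume "i \<notin> {..<n}"
      then have "i = (i - n) + n" by simp
      then show False using i by blast
    qed
  qed auto
  ultimately show "embedding_on G (verts G) (shift (\<lambda>j. j + n))"
    "shift (\<lambda>j. j + n) ` verts G = verts G - (\<Union>i<n. s i ` K)"
    using shift_embedding[of "\<lambda>j. j + n"] by simp_all
qed

text \<open>
  The composition \<open>e\<close> of an isomorphism from \<open>G\<close> onto the graph without its first \<open>n\<close> copies, of \<open>\<psi>\<close>,
  and of a shift that skips the copy \<open>m\<close> is an embedding whose image misses \<open>s m x\<close> but contains
  some \<open>s i x\<close> with \<open>i < m\<close>. Of the copies \<open>i\<close> and \<open>m\<close> no other vertex lies in the image, so nothing is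
  left that could tell \<open>s i x\<close> from \<open>s m x\<close>. This makes \<open>s m x\<close> removable by itself.
\<close>

lemma truncated_not_isomorphic:
  assumes "star_like G" "x \<in> K" "K - {x} \<noteq> {}" "\<not> removable G (K - {x})" "n < m"
  shows "\<not> isomorphic (induce G (truncated x n)) (induce G (truncated x m))"
proof
  assume "isomorphic (induce G (truncated x n)) (induce G (truncated x m))"
  then obtain \<psi> where \<psi>: "embedding_on G (truncated x n) \<psi>" "\<psi> ` truncated x n = truncated x m"
    using isomorphic_induce_iff[of "truncated x n" G "truncated x m"] by (auto simp: truncated_def)
  \<comment> \<open>\<open>X n\<close> is what is left of the truncated copies.\<close>
  define X where "X n = (\<lambda>i. s i x) ` {..<n}" for n
  have X_card: "card (X n) = n" "finite (X n)" for n
    unfolding X_def using assms(2) by (simp_all add: card_image inj_on_def)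
  have X_sub: "X m \<subseteq> truncated x m"
    using copy_in_truncated[OF assms(2)] by (auto simp: X_def)
  have "\<exists>d\<in>truncated x n - X n. \<psi> d \<in> X m"
  proof (rule ccontr)
    assume "\<not> ?thesis"
    then have "X m \<subseteq> \<psi> ` X n" using X_sub \<psi>(2) by (force simp: image_iff)
    then have "card (X m) \<le> card (X n)"
      using X_card(2)[of n] by (meson card_image_le card_mono finite_imageI le_trans)
    then show False using X_card \<open>n < m\<close> by simp
  qed
  then obtain d i where d: "d \<in> truncated x n" "d \<notin> X n" and i: "\<psi> d = s i x" "i < m"
    by (auto simp: X_def)
  have h: "embedding_on G (verts G) (shift (\<lambda>j. j + n))"
    "shift (\<lambda>j. j + n) ` verts G = verts G - (\<Union>i<n. s i ` K)"
    by (rule shift_past)+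
  have "d \<in> shift (\<lambda>j. j + n) ` verts G"
    using d assms(2) unfolding h(2) by (auto simp: truncated_def X_def)
  then obtain c where c: "c \<in> verts G" "d = shift (\<lambda>j. j + n) c" by blast
  \<comment> \<open>Skipping the index \<open>m\<close> makes room for one more truncated copy, with left-over vertex \<open>s m x\<close>.\<close>
  define \<pi> where "\<pi> j = (if j < m then j else Suc j)" for j
  have "inj \<pi>" by (auto simp: \<pi>_def inj_def split: if_splits)
  have "j \<in> range \<pi>" if "j \<noteq> m" for j
    using that by (cases "j < m") (auto simp: \<pi>_def image_iff intro: exI[of _ j] exI[of _ "j - 1"])
  then have "- range \<pi> = {m}" by (auto simp: \<pi>_def split: if_splits)
  then have g: "embedding_on G (verts G) (shift \<pi>)" "shift \<pi> ` verts G = verts G - s m ` K"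
    using shift_embedding[OF \<open>inj \<pi>\<close>] by simp_all
  define e where "e = shift \<pi> \<circ> (\<psi> \<circ> shift (\<lambda>j. j + n))"
  have sub: "verts G - (\<Union>i<n. s i ` K) \<subseteq> truncated x n" by (auto simp: truncated_def)
  have tr: "truncated x m \<subseteq> verts G" by (auto simp: truncated_def)
  have "embedding_on G (verts G) (\<psi> \<circ> shift (\<lambda>j. j + n))"
    using h sub \<psi>(1) by (intro embedding_on_comp) auto
  moreover have h_tr: "(\<psi> \<circ> shift (\<lambda>j. j + n)) ` verts G \<subseteq> truncated x m"
    using image_mono[OF sub, of \<psi>] unfolding image_comp[symmetric] h(2) \<psi>(2) .
  ultimately have e: "embedding_on G (verts G) e"
    unfolding e_def by (intro embedding_on_comp[OF _ embedding_on_subset[OF g(1) tr]])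
  have e_in: "e ` verts G \<subseteq> shift \<pi> ` truncated x m"
    using h_tr unfolding e_def image_comp[symmetric] by blast
  define L where "L = verts G - e ` verts G"
  have e_im: "e ` verts G = verts G - L" using e by (auto simp: L_def embedding_on_def)
  have e_c: "e c = s i x" using c i assms(2) by (simp add: e_def \<pi>_def)
  have mL: "s m x \<in> L"
  proof -
    have "s m x \<notin> e ` verts G" using e_in g(2) tr assms(2) by blast
    then show ?thesis using assms(2) by (simp add: L_def)
  qed
  have "removable G L" unfolding removable_def using e e_im mL by (auto simp: L_def)
  have twin: "adj G z (s i x) \<longleftrightarrow> adj G z (s m x)" if z: "z \<in> verts G - L" "z \<noteq> s i x" for z
  proof (rule adj_outside[OF assms(2)])
    obtain w where w: "w \<in> truncated x m" "z = shift \<pi> w" using z(1) e_in e_im by blast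
    show "z \<in> verts G" using z by simp
    show "z \<notin> s m ` K" using w g(2) tr by blast
    show "z \<notin> s i ` K"
    proof (cases "\<exists>j. w \<in> s j ` K")
      case True
      then obtain j k where k: "k \<in> K" "w = s j k" by blast
      have "k = x" if "j = i" using w(1) k that i(2) by (auto simp: truncated_def)
      then show ?thesis using w(2) k z(2) i(2) by (auto simp: \<pi>_def split: if_splits)
    next
      case False
      then show ?thesis using w(2) by (simp add: shift_outside)
    qed
  qed
  have "removable G {s m x}"
  proof (rule twin_of_removed_vertex[OF assms(1) \<open>removable G L\<close> mL])
    show "s i x \<in> verts G - L" using e_c c(1) e_im by (metis imageI)
  qed (use twin in auto)
  \<comment> \<open>Exchanging the copies \<open>0\<close> and \<open>m\<close> is an automorphism that takes \<open>s m x\<close> to \<open>x\<close>.\<close>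
  define \<tau> where "\<tau> j = (if j = 0 then m else if j = m then 0 else j)" for j
  have "\<tau> (\<tau> j) = j" for j by (simp add: \<tau>_def)
  then have "inj \<tau>" "range \<tau> = UNIV" by (metis injI, metis surjI)
  then have \<beta>: "embedding_on G (verts G) (shift \<tau>)" "shift \<tau> ` verts G = verts G"
    using shift_embedding[of \<tau>] by simp_all
  have \<beta>_x: "shift \<tau> (s m x) = x"
    using assms(2,5) by (simp add: \<tau>_def copy_0)
  have "removable G (K - {x})" if same: "\<And>k. k \<in> K - {x} \<Longrightarrow> adj G k x \<longleftrightarrow> adj G k (s 1 x)"
  proof -
    have "interchangeable_copies G (K - {x}) s" by (rule copies_of_part) (use same in auto)
    then show ?thesis using assms(3) by (rule interchangeable_copies.original_removable)
  qed
  \<comment> \<open>Some \<open>k\<close> tells \<open>x\<close> from \<open>s 1 x\<close>, hence also from \<open>s m x\<close>, which is impossible for twins.\<close>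
  then obtain k where k: "k \<in> K" "k \<noteq> x" "adj G k x \<noteq> adj G k (s 1 x)"
    using assms(4) by blast
  have "k \<noteq> s m x" using copy_eq_iff[of k x 0 m] k assms(2,5) by (simp add: copy_0)
  then have "adj G k x \<longleftrightarrow> adj G k (s m x)"
    using removable_vertex_twins[OF assms(1) \<open>removable G {s m x}\<close> \<beta>, of k] k original_subset
    by (auto simp: \<beta>_x)
  also have "\<dots> \<longleftrightarrow> adj G k (s 1 x)"
    using adj_across[of k x 0 m 0 1] k assms(2,5) by (simp add: copy_0)
  finally show False using k(3) by simp
qed

end

section \<open>From a strong twin to a critical vertex\<close>

text \<open>
  Adding the vertices of \<open>F\<close> to \<open>Q\<close> one by one passes from a set that is not removable to one that
  is, so some single vertex makes the difference.
\<close>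

lemma removable_single_step:
  assumes "finite F" "removable G (Q \<union> F)" "\<not> removable G Q"
  obtains K x where "removable G K" "x \<in> K" "Q \<subseteq> K - {x}" "\<not> removable G (K - {x})"
proof -
  have "\<exists>K x. removable G K \<and> x \<in> K \<and> Q \<subseteq> K - {x} \<and> \<not> removable G (K - {x})"
    using assms(1,2)
  proof (induction F rule: finite_induct)
    case empty
    then show ?case using assms(3) by simp
  next
    case (insert a F)
    show ?case
    proof (cases "removable G (Q \<union> F)")
      case True
      then show ?thesis by (rule insert.IH)
    next
      case False
      then have "a \<notin> Q" using insert.prems by (metis Un_insert_right insert_absorb Un_insert_left)
      then have "Q \<union> insert a F - {a} = Q \<union> F" using insert.hyps by auto
      then show ?thesis using insert.prems False \<open>a \<notin> Q\<close>
        by (intro exI[of _ "Q \<union> insert a F"] exI[of _ a]) auto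
    qed
  qed
  then show ?thesis using that by blast
qed

lemma proper_induced_subgraphD:
  assumes "proper_induced_subgraph H B"
  shows "H = induce B (verts H)" "verts H \<subseteq> verts B" "H \<noteq> B"
  using assms unfolding proper_induced_subgraph_def induced_subgraph_def by blast+

lemma proper_induced_subgraph_induce:
  assumes "A \<subseteq> B" "B \<subseteq> verts G" "A \<noteq> B"
  shows "proper_induced_subgraph (induce G A) (induce G B)"
proof -
  have "verts (induce G A) = A" "verts (induce G B) = B"
    using assms(1,2) verts_induce[of _ G] by auto
  moreover from this have "induce G A \<noteq> induce G B" using assms(3) by metis
  ultimately show ?thesis
    using assms(1,2) induce_induce[of A B G]
    unfolding proper_induced_subgraph_def induced_subgraph_def by metis
qed

text \<open>
  \<open>A\<close> is the vertex set of a copy of \<open>T\<close> in \<open>G\<close>, and \<open>e\<close> embeds \<open>G\<close> into \<open>T\<close> and then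
  into \<open>G\<close>.
\<close>

lemma strong_twin_between:
  fixes G :: "'a graph" and T :: "'b graph"
  assumes "strong_twins G T"
  obtains A e where "A \<subseteq> verts G" "isomorphic T (induce G A)" "A \<noteq> verts G"
    "embedding_on G (verts G) e" "e ` verts G \<subseteq> A"
proof -
  have G: "simple_graph G" using assms by (simp add: strong_twins_def)
  obtain H g where "proper_induced_subgraph H T" and g: "graph_iso g G H"
    using assms unfolding strong_twins_def isomorphic_def by blast
  note H = proper_induced_subgraphD[OF this(1)]
  obtain H' f where "proper_induced_subgraph H' G" and f': "graph_iso f T H'"
    using assms unfolding strong_twins_def isomorphic_def by blast
  note H' = proper_induced_subgraphD[OF this(1)]
  define A where "A = verts H'"
  have A: "A \<subseteq> verts G" "induce G A \<noteq> G" and f: "graph_iso f T (induce G A)"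
    using H'(2,3) f' unfolding A_def H'(1)[symmetric] by auto
  have "A \<noteq> verts G" using A induce_verts[OF G] by auto
  have gV: "g u \<in> verts H" "g u \<in> verts T" if "u \<in> verts G" for u
    using g H(2) that by (auto simp: graph_iso_def bij_betw_def)
  have fV: "f v \<in> A" if "v \<in> verts T" for v
    using f that verts_induce[OF A(1)] by (auto simp: graph_iso_def bij_betw_def)
  have "inj_on (f \<circ> g) (verts G)"
  proof (rule comp_inj_on)
    show "inj_on g (verts G)" using g by (simp add: graph_iso_def bij_betw_def)
    have "inj_on f (verts T)" using f by (simp add: graph_iso_def bij_betw_def)
    then show "inj_on f (g ` verts G)" by (rule inj_on_subset) (use gV in blast)
  qed
  moreover have "adj G (f (g u)) (f (g v)) \<longleftrightarrow> adj G u v"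
    if uv: "u \<in> verts G" "v \<in> verts G" for u v
  proof -
    have "adj G u v \<longleftrightarrow> {g u, g v} \<in> edges (induce T (verts H))"
      using g uv H(1) by (simp add: graph_iso_def adj_def)
    also have "\<dots> \<longleftrightarrow> {g u, g v} \<in> edges T" using gV uv by (simp add: induce_def)
    also have "\<dots> \<longleftrightarrow> {f (g u), f (g v)} \<in> edges (induce G A)"
      using f gV uv by (simp add: graph_iso_def)
    also have "\<dots> \<longleftrightarrow> adj G (f (g u)) (f (g v))"
      using fV gV uv by (simp add: induce_def adj_def)
    finally show ?thesis by simp
  qed
  ultimately have "embedding_on G (verts G) (f \<circ> g)" "(f \<circ> g) ` verts G \<subseteq> A"
    using gV fV A(1) by (auto simp: embedding_on_def)
  moreover have "isomorphic T (induce G A)" using f by (auto simp: isomorphic_def)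
  ultimately show ?thesis using that A(1) \<open>A \<noteq> verts G\<close> by blast
qed

text \<open>
  With \<open>A\<close> and \<open>e\<close> from \<open>strong_twin_between\<close>, the complement \<open>K\<close> of the image of \<open>e\<close> is removable, and its part
  outside \<open>A\<close> is not, because \<open>T\<close> is not isomorphic to \<open>G\<close>. Being ordinary then yields a
  non-removable \<open>Q\<close> that differs from \<open>K\<close> by finitely many vertices only.
\<close>

lemma ordinary_critical_vertex:
  fixes G :: "'a graph" and T :: "'b graph"
  assumes "ordinary G" "strong_twins G T"
  obtains K x where "removable G K" "x \<in> K" "K - {x} \<noteq> {}" "\<not> removable G (K - {x})"
proof -
  have G: "simple_graph G" "verts G \<noteq> {}"
    using assms(1) by (auto simp: ordinary_def star_like_def self_contained_def)
  obtain A e where A: "A \<subseteq> verts G" "isomorphic T (induce G A)" "A \<noteq> verts G"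
    and e: "embedding_on G (verts G) e" "e ` verts G \<subseteq> A"
    using strong_twin_between[OF assms(2)] .
  define K where "K = verts G - e ` verts G"
  define P where "P = verts G - A"
  have "e ` verts G = verts G - K" using e A(1) by (auto simp: K_def)
  moreover have P: "P \<subseteq> K" "P \<noteq> {}" using e A by (auto simp: K_def P_def)
  moreover have K: "K \<subseteq> verts G" by (simp add: K_def)
  ultimately have K_rem: "removable G K" using e(1) by (auto simp: removable_def)
  have "\<not> removable G P"
  proof
    assume "removable G P"
    then have "isomorphic (induce G (verts G - P)) G"
      using removable_iff_isomorphic[of G P] G by (simp add: P_def)
    moreover have "verts G - P = A" using A(1) by (auto simp: P_def)
    ultimately have "isomorphic T G" using A(2) isomorphic_trans by metis
    then show False using assms(2) isomorphic_sym by (auto simp: strong_twins_def)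
  qed
  then have "induce G P \<notin> Rem G" using removable_iff_Rem[of G P] G by (simp add: P_def)
  moreover have "induced_subgraph (induce G P) (induce G K)"
    using P K by (simp add: induced_subgraph_def verts_induce induce_induce)
  moreover have "verts (induce G P) \<noteq> {}" using P K by (simp add: verts_induce)
  moreover have "induce G K \<in> Rem G" using K_rem removable_iff_Rem[OF G K] by simp
  ultimately obtain P' where P': "induced_subgraph P' (induce G K)" "verts P' \<noteq> {}"
    "P' \<notin> Rem G" "finite (verts (graph_diff (induce G K) P'))"
    using assms(1) unfolding ordinary_def by blast
  define Q where "Q = verts P'"
  have Q: "Q \<subseteq> K" "P' = induce G Q"
    using P'(1) K by (auto simp: Q_def induced_subgraph_def verts_induce induce_induce)
  have "\<not> removable G Q" using P'(3) Q K removable_iff_Rem[of G Q] G by auto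
  moreover have "finite (K - Q)"
    using P'(4) Q K by (simp add: graph_diff_def verts_induce flip: Q_def)
  moreover have "removable G (Q \<union> (K - Q))" using K_rem Q(1) by (simp add: Un_absorb1)
  ultimately obtain K' x where "removable G K'" "x \<in> K'" "Q \<subseteq> K' - {x}"
    "\<not> removable G (K' - {x})"
    by (metis removable_single_step)
  then show ?thesis using that P'(2) Q_def by blast
qed

section \<open>Infinitely many strong twins\<close>

theorem theorem2p7:
  fixes G :: "'a graph"
  assumes "self_contained G" and "star_like G" and "ordinary G"
  shows "(\<nexists>T :: 'b graph. strong_twins G T) \<or>
         (\<exists>S :: 'a graph set. infinite S \<and> (\<forall>T\<in>S. strong_twins G T) \<and>
            pairwise (\<lambda>T T'. \<not> isomorphic T T') S)"
proof (rule disjCI)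
  assume "\<not> (\<exists>S :: 'a graph set. infinite S \<and> (\<forall>T\<in>S. strong_twins G T) \<and>
            pairwise (\<lambda>T T'. \<not> isomorphic T T') S)"
  moreover have "\<exists>S :: 'a graph set. infinite S \<and> (\<forall>T\<in>S. strong_twins G T) \<and>
            pairwise (\<lambda>T T'. \<not> isomorphic T T') S"
    if T: "strong_twins G T" for T :: "'b graph"
  proof -
    obtain K x where K: "removable G K" and x: "x \<in> K" "K - {x} \<noteq> {}" "\<not> removable G (K - {x})"
      using ordinary_critical_vertex[OF assms(3) T] .
    obtain s where "interchangeable_copies G K s" using star_like_copies[OF assms(2) K] .
    then interpret interchangeable_copies G K s .
    define T where "T n = induce G (truncated x n)" for n
    have tr: "truncated x n \<subseteq> verts G" for n by (auto simp: truncated_def)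
    have T0: "T 0 = G" by (simp add: T_def truncated_def induce_verts[OF simple])
    have noniso: "\<not> isomorphic (T n) (T m)" if "n \<noteq> m" for n m
      using that truncated_not_isomorphic[OF assms(2) x] isomorphic_sym
      unfolding T_def by (metis linorder_neqE_nat)
    have refl: "isomorphic (T n) (T n)" for n
      by (auto simp: isomorphic_def graph_iso_def intro!: exI[of _ id])
    have twins: "strong_twins G (T (Suc n))" for n
    proof -
      let ?A = "verts G - (\<Union>i<Suc n. s i ` K)"
      have sub: "?A \<subseteq> truncated x (Suc n)" by (auto simp: truncated_def)
      have "x \<in> s 0 ` K" using x(1) by (simp add: copy_0_image)
      then have "x \<notin> ?A" by auto
      moreover have "x \<in> truncated x (Suc n)"
        using copy_in_truncated[OF x(1), of 0] x(1) by (simp add: copy_0)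
      ultimately have "?A \<noteq> truncated x (Suc n)" by blast
      then have "proper_induced_subgraph (induce G ?A) (T (Suc n))"
        unfolding T_def by (rule proper_induced_subgraph_induce[OF sub tr])
      moreover have "isomorphic (induce G (verts G)) (induce G ?A)"
        using shift_past[of "Suc n"] isomorphic_induce_iff[of "verts G" G ?A] by blast
      ultimately have big: "\<exists>H. proper_induced_subgraph H (T (Suc n)) \<and> isomorphic G H"
        using induce_verts[OF simple] by metis
      have noniso_G: "\<not> isomorphic G (T (Suc n))" using noniso[of 0 "Suc n"] T0 by simp
      have "truncated x (Suc n) \<noteq> verts G"
        using noniso_G refl[of 0] T0 induce_verts[OF simple] unfolding T_def by metis
      then have "proper_induced_subgraph (T (Suc n)) G"
        using proper_induced_subgraph_induce[OF tr order_refl] induce_verts[OF simple]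
        unfolding T_def by metis
      then have "\<exists>H. proper_induced_subgraph H G \<and> isomorphic (T (Suc n)) H"
        using refl by blast
      moreover have "simple_graph (T (Suc n))"
        unfolding T_def using simple by (rule simple_graph_induce)
      ultimately show ?thesis
        unfolding strong_twins_def using simple noniso_G big by blast
    qed
    have "inj (\<lambda>n. T (Suc n))"
    proof (rule injI)
      fix n m assume "T (Suc n) = T (Suc m)"
      then have "isomorphic (T (Suc n)) (T (Suc m))" using refl by simp
      then show "n = m" using noniso[of "Suc n" "Suc m"] by blast
    qed
    then have "infinite (range (\<lambda>n. T (Suc n)))" by (simp add: finite_image_iff)
    moreover have "pairwise (\<lambda>T T'. \<not> isomorphic T T') (range (\<lambda>n. T (Suc n)))"
      by (rule pairwiseI) (metis noniso rangeE)
    ultimately show ?thesis using twins by blast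
  qed
  ultimately show "\<nexists>T :: 'b graph. strong_twins G T" by blast
qed

end
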